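(* Let $(f_n)_{n\in\mathbb{N}}$ be a martingale on a filtered probability space $(\Omega,(\mathcal{F}_n)_{n\in\mathbb{N}})$ with values in a Hilbert space $(H,|\cdot|)$. Let $(w_n)_{n\in\mathbb{N}}$ be an adapted sequence of weights (that need not be a martingale). Then, for every $N\in\mathbb{N}$, we have $$\mathbb{E}\Bigl( |f_0| + \frac{1}{3}\sum_{n=1}^{N} \frac{|df_n|^2}{f^*_n}\Bigr) \leq \mathbb{E}( f^*_N )$$ and $$\mathbb{E}\Bigl( |f_0| w_0 + \frac{1}{4}\sum_{n=1}^{N} \frac{|df_n|^2}{f^*_n} w_n\Bigr) \leq \mathbb{E}( f^*_N w^*_N ).$$
   Context: Here $\mathbb{N}=\{0,1,2,\dots\}$. A weight is a positive random variable on $\Omega$; adapted means that $w_n$ is $\mathcal{F}_n$-measurable for every $n$. Martingale differences and running maxima are denoted by $df_n = f_n - f_{n-1}$ (for $n\geq 1$), $f^*_n := \max_{n'\leq n} |f_{n'}|$, $w^*_n := \max_{n'\leq n} w_{n'}$. Expectations of nonnegative random variables take values in $[0,\infty]$. The quotient $|df_n|^2/f^*_n$ is interpreted as $0$ where $f^*_n=0$ (in which case also $df_n=0$). *)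

theory Defs
  imports "HOL-Probability.Probability"
begin

text \<open>
  The library's Bochner integral is restricted to second countable spaces. The two definitions
  below state strong measurability and the Bochner integral for an arbitrary normed space, so that
  non-separable Hilbert spaces are covered; the lemmas after them show that on second countable
  spaces they are the library's notions.
\<close>

definition strongly_measurable :: "'a measure \<Rightarrow> ('a \<Rightarrow> 'b::real_normed_vector) \<Rightarrow> bool" where
  "strongly_measurable M f \<longleftrightarrow>
    (\<exists>s. (\<forall>i. simple_function M (s i)) \<and> (\<forall>x\<in>space M. (\<lambda>i. s i x) \<longlonglongrightarrow> f x))"

definition has_strong_integral ::
    "'a measure \<Rightarrow> ('a \<Rightarrow> 'b::real_normed_vector) \<Rightarrow> 'b \<Rightarrow> bool" where
  "has_strong_integral M f I \<longleftrightarrow>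
    strongly_measurable M f \<and>
    (\<exists>s. (\<forall>i. Bochner_Integration.simple_bochner_integrable M (s i)) \<and>
         (\<lambda>i. \<integral>\<^sup>+x. ennreal (norm (f x - s i x)) \<partial>M) \<longlonglongrightarrow> 0 \<and>
         (\<lambda>i. Bochner_Integration.simple_bochner_integral M (s i)) \<longlonglongrightarrow> I)"

lemma strongly_measurable_iff_borel_measurable:
  fixes f :: "'a \<Rightarrow> 'b::{real_normed_vector, second_countable_topology}"
  shows "strongly_measurable M f \<longleftrightarrow> f \<in> borel_measurable M"
proof
  assume "strongly_measurable M f"
  then obtain s where s: "\<And>i. simple_function M (s i)"
    and lim: "\<And>x. x \<in> space M \<Longrightarrow> (\<lambda>i. s i x) \<longlonglongrightarrow> f x"
    unfolding strongly_measurable_def by blast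
  show "f \<in> borel_measurable M"
    using lim by (rule borel_measurable_LIMSEQ_metric[rotated])
      (auto intro: borel_measurable_simple_function s)
next
  assume "f \<in> borel_measurable M"
  from borel_measurable_implies_sequence_metric[OF this, of 0]
  show "strongly_measurable M f"
    unfolding strongly_measurable_def by blast
qed

lemma has_strong_integral_iff_has_bochner_integral:
  fixes f :: "'a \<Rightarrow> 'b::{real_normed_vector, second_countable_topology}"
  shows "has_strong_integral M f I \<longleftrightarrow> has_bochner_integral M f I"
  unfolding has_strong_integral_def has_bochner_integral.simps
    strongly_measurable_iff_borel_measurable by blast

text \<open>\<open>g\<close> is (a version of) the conditional expectation of \<open>f\<close> given \<open>G\<close>.
  The case \<open>A = space M\<close> makes \<open>f\<close> and \<open>g\<close> integrable.\<close>

definition is_cond_exp ::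
    "'a measure \<Rightarrow> 'a measure \<Rightarrow> ('a \<Rightarrow> 'b::real_normed_vector) \<Rightarrow> ('a \<Rightarrow> 'b) \<Rightarrow> bool" where
  "is_cond_exp M G f g \<longleftrightarrow>
    strongly_measurable G g \<and>
    (\<forall>A\<in>sets G. \<exists>I. has_strong_integral M (\<lambda>x. indicator A x *\<^sub>R f x) I \<and>
                    has_strong_integral M (\<lambda>x. indicator A x *\<^sub>R g x) I)"

locale filtered_prob_space = prob_space M + filtration "space M" F
  for M :: "'a measure" and F :: "nat \<Rightarrow> 'a measure" +
  assumes subalgebra_F: "\<And>n. subalgebra M (F n)"

definition martingale ::
    "'a measure \<Rightarrow> (nat \<Rightarrow> 'a measure) \<Rightarrow> (nat \<Rightarrow> 'a \<Rightarrow> 'b::real_normed_vector) \<Rightarrow> bool" where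
  "martingale M F f \<longleftrightarrow>
    (\<forall>n. strongly_measurable (F n) (f n)) \<and>
    (\<forall>n. \<exists>I. has_strong_integral M (f n) I) \<and>
    (\<forall>m n. m \<le> n \<longrightarrow> is_cond_exp M (F m) (f n) (f m))"

definition weight :: "'a measure \<Rightarrow> ('a \<Rightarrow> real) \<Rightarrow> bool" where
  "weight M w \<longleftrightarrow> w \<in> borel_measurable M \<and> (\<forall>x\<in>space M. 0 < w x)"

text \<open>Only used for \<open>n \<ge> 1\<close>; the value at \<open>n = 0\<close> is junk.\<close>

definition mdiff :: "(nat \<Rightarrow> 'a \<Rightarrow> 'b::real_normed_vector) \<Rightarrow> nat \<Rightarrow> 'a \<Rightarrow> 'b" where
  "mdiff f n x = f n x - f (n - 1) x"

definition running_max :: "(nat \<Rightarrow> 'a \<Rightarrow> real) \<Rightarrow> nat \<Rightarrow> 'a \<Rightarrow> real" where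
  "running_max u n x = Max ((\<lambda>k. u k x) ` {..n})"

definition max_fun :: "(nat \<Rightarrow> 'a \<Rightarrow> 'b::real_normed_vector) \<Rightarrow> nat \<Rightarrow> 'a \<Rightarrow> real" where
  "max_fun f = running_max (\<lambda>k x. norm (f k x))"

end

theory Submission
  imports Defs
begin

text \<open>
  Write \<open>x = f\<^sub>n\<^sub>-\<^sub>1\<close>, \<open>y = f\<^sub>n\<close> and let \<open>m\<close>, \<open>m'\<close> and \<open>v\<close>, \<open>v'\<close> be the corresponding running maxima
  of \<open>|f|\<close> and \<open>w\<close>. The proof rests on the pathwise inequality
  \<open>|y - x|\<^sup>2 v' / m' \<le> |y|\<^sup>2 v' / m' - |x|\<^sup>2 v / m - 2 \<langle>x, y - x\<rangle> v / m + C (m' v' - m v)\<close>,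
  valid with \<open>C = 3\<close>, and with \<open>C = 2\<close> when \<open>v' = v\<close>. In the sum over \<open>n\<close> all terms telescope except
  the one linear in the increment, which has expectation zero because its coefficient \<open>x v / m\<close> is
  predictable; as \<open>|f\<^sub>N|\<^sup>2 / f\<^sup>*\<^sub>N \<le> f\<^sup>*\<^sub>N\<close>, the total is at most
  \<open>(C + 1) (f\<^sup>*\<^sub>N w\<^sup>*\<^sub>N - |f\<^sub>0| w\<^sub>0)\<close>.
\<close>

section \<open>Strong measurability and strong integrals\<close>

lemma strongly_measurable_subalgebra:
  assumes "strongly_measurable G f" "subalgebra M G"
  shows "strongly_measurable M f"
  using assms unfolding strongly_measurable_def subalgebra_def simple_function_def
  by (metis subsetD)

text \<open>Composing the simple approximants of both arguments with a jointly continuous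
  \<open>h\<close> gives simple approximants of the result. This argument needs no separability, so
  norms, scalar multiples, differences and inner products can all be handled in an arbitrary Hilbert
  space.\<close>

lemma strongly_measurable_compose2:
  assumes "strongly_measurable M f" "strongly_measurable M g"
    and "continuous_on UNIV (\<lambda>p. h (fst p) (snd p))"
  shows "strongly_measurable M (\<lambda>x. h (f x) (g x))"
proof -
  obtain s t where s: "\<And>i. simple_function M (s i)" "\<And>x. x \<in> space M \<Longrightarrow> (\<lambda>i. s i x) \<longlonglongrightarrow> f x"
    and t: "\<And>i. simple_function M (t i)" "\<And>x. x \<in> space M \<Longrightarrow> (\<lambda>i. t i x) \<longlonglongrightarrow> g x"
    using assms(1,2) unfolding strongly_measurable_def by blast
  have "(\<lambda>i. h (s i x) (t i x)) \<longlonglongrightarrow> h (f x) (g x)" if "x \<in> space M" for x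
    using continuous_on_tendsto_compose[OF assms(3) tendsto_Pair[OF s(2)[OF that] t(2)[OF that]]]
    by simp
  then show ?thesis
    unfolding strongly_measurable_def
    by (intro exI[of _ "\<lambda>i x. h (s i x) (t i x)"])
      (auto intro: simple_function_compose2 s(1) t(1))
qed

lemma strongly_measurable_norm:
  assumes "strongly_measurable M f"
  shows "(\<lambda>x. norm (f x)) \<in> borel_measurable M"
  using strongly_measurable_compose2[OF assms assms, of "\<lambda>a b. norm a"]
  by (simp add: strongly_measurable_iff_borel_measurable continuous_intros)

lemma strongly_measurable_scaleR:
  assumes "r \<in> borel_measurable M" "strongly_measurable M f"
  shows "strongly_measurable M (\<lambda>x. r x *\<^sub>R f x)"
  using strongly_measurable_compose2[OF _ assms(2), of r scaleR] assms(1)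
  by (simp add: strongly_measurable_iff_borel_measurable continuous_intros)

lemma strongly_measurable_diff:
  assumes "strongly_measurable M f" "strongly_measurable M g"
  shows "strongly_measurable M (\<lambda>x. f x - g x)"
  using strongly_measurable_compose2[OF assms, of "(-)"] by (simp add: continuous_intros)

text \<open>The functional \<open>inner c\<close> is linear and, by Cauchy-Schwarz, bounded by
  \<open>norm c\<close>, so it carries an approximating sequence of \<open>f\<close> to one of
  \<open>inner c (f x)\<close>. This reduces vector-valued conditional expectations to real
  integrals.\<close>

lemma has_strong_integral_inner:
  fixes f :: "'a \<Rightarrow> 'h::real_inner"
  assumes "has_strong_integral M f I"
  shows "has_bochner_integral M (\<lambda>x. inner c (f x)) (inner c I)"
proof -
  obtain s where f: "strongly_measurable M f"
    and s: "\<And>i. Bochner_Integration.simple_bochner_integrable M (s i)"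
    and lim: "(\<lambda>i. \<integral>\<^sup>+x. ennreal (norm (f x - s i x)) \<partial>M) \<longlonglongrightarrow> 0"
    and I: "(\<lambda>i. Bochner_Integration.simple_bochner_integral M (s i)) \<longlonglongrightarrow> I"
    using assms unfolding has_strong_integral_def by blast
  have meas: "(\<lambda>x. norm (f x - s i x)) \<in> borel_measurable M" for i
  proof (intro strongly_measurable_norm strongly_measurable_diff f)
    show "strongly_measurable M (s i)"
      unfolding strongly_measurable_def
      by (rule exI[of _ "\<lambda>_. s i"]) (use s in \<open>auto elim: simple_bochner_integrable.cases\<close>)
  qed
  have lin: "linear (inner c)"
    by (simp add: linear_iff inner_add_right)
  show ?thesis
  proof (rule has_bochner_integral.intros[where s = "\<lambda>i x. inner c (s i x)"])
    show "(\<lambda>x. inner c (f x)) \<in> borel_measurable M"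
      using strongly_measurable_compose2[OF f f, of "\<lambda>a b. inner c a"]
      by (simp add: strongly_measurable_iff_borel_measurable continuous_intros)
    show "Bochner_Integration.simple_bochner_integrable M (\<lambda>x. inner c (s i x))" for i
      by (rule simple_bochner_integrable_compose2[OF _ s s, where p = "\<lambda>a b. inner c a"]) simp
    show "(\<lambda>i. Bochner_Integration.simple_bochner_integral M (\<lambda>x. inner c (s i x))) \<longlonglongrightarrow> inner c I"
      using tendsto_inner[OF tendsto_const I]
      by (simp add: simple_bochner_integral_linear[OF lin s])
    show "(\<lambda>i. \<integral>\<^sup>+x. ennreal (norm (inner c (f x) - inner c (s i x))) \<partial>M) \<longlonglongrightarrow> 0"
    proof (rule tendsto_sandwich[of "\<lambda>_. 0"])
      show "(\<lambda>i. ennreal (norm c) * (\<integral>\<^sup>+x. ennreal (norm (f x - s i x)) \<partial>M)) \<longlonglongrightarrow> 0"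
        using ennreal_tendsto_cmult[OF _ lim, of "ennreal (norm c)"] by simp
      have "(\<integral>\<^sup>+x. ennreal (norm (inner c (f x) - inner c (s i x))) \<partial>M)
          \<le> (\<integral>\<^sup>+x. ennreal (norm c) * ennreal (norm (f x - s i x)) \<partial>M)" for i
        by (intro nn_integral_mono)
          (simp add: Cauchy_Schwarz_ineq2 flip: inner_diff_right ennreal_mult)
      then show "\<forall>\<^sub>F i in sequentially. (\<integral>\<^sup>+x. ennreal (norm (inner c (f x) - inner c (s i x))) \<partial>M)
          \<le> ennreal (norm c) * (\<integral>\<^sup>+x. ennreal (norm (f x - s i x)) \<partial>M)"
        using meas by (simp add: nn_integral_cmult)
    qed auto
  qed
qed

text \<open>One simple approximant at finite L1 distance suffices: its norm plus the norm of the
  error is integrable and dominates \<open>norm (f x)\<close>.\<close>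

lemma has_strong_integral_integrable_norm:
  assumes "has_strong_integral M f I"
  shows "integrable M (\<lambda>x. norm (f x))"
proof -
  obtain s where f: "strongly_measurable M f"
    and s: "\<And>i. Bochner_Integration.simple_bochner_integrable M (s i)"
    and lim: "(\<lambda>i. \<integral>\<^sup>+x. ennreal (norm (f x - s i x)) \<partial>M) \<longlonglongrightarrow> 0"
    using assms unfolding has_strong_integral_def by blast
  have "\<forall>\<^sub>F i in sequentially. (\<integral>\<^sup>+x. ennreal (norm (f x - s i x)) \<partial>M) < 1"
    using order_tendstoD(2)[OF lim, of 1] by simp
  then obtain i where i: "(\<integral>\<^sup>+x. ennreal (norm (f x - s i x)) \<partial>M) < 1"
    by (auto simp: eventually_sequentially)
  have "strongly_measurable M (s i)"
    unfolding strongly_measurable_def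
    by (rule exI[of _ "\<lambda>_. s i"]) (use s in \<open>auto elim: simple_bochner_integrable.cases\<close>)
  then have meas: "(\<lambda>x. norm (f x - s i x)) \<in> borel_measurable M"
    by (intro strongly_measurable_norm strongly_measurable_diff f)
  have "Bochner_Integration.simple_bochner_integrable M (\<lambda>x. norm (s i x))"
    by (rule simple_bochner_integrable_compose2[OF _ s s, where p = "\<lambda>a b. norm a"]) simp
  then have "integrable M (\<lambda>x. norm (s i x))"
    using has_bochner_integral_simple_bochner_integrable integrable.intros by blast
  moreover have "integrable M (\<lambda>x. norm (f x - s i x))"
    using i meas by (auto intro!: integrableI_bounded intro: order_less_trans[OF _ ennreal_one_less_top])
  ultimately have "integrable M (\<lambda>x. norm (s i x) + norm (f x - s i x))"
    by simp
  then show ?thesis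
    by (rule Bochner_Integration.integrable_bound)
      (auto intro: strongly_measurable_norm f norm_triangle_sub)
qed

section \<open>Martingale increments are orthogonal to predictable functions\<close>

text \<open>On each of the finitely many level sets \<open>A c\<close> of \<open>h\<close>, a set of
  \<open>G\<close>, the integrand is \<open>inner c (f x - g x)\<close>, and the defining property
  of conditional expectation applies after pairing with \<open>c\<close>.\<close>

lemma is_cond_exp_simple_orthogonal:
  fixes f g :: "'a \<Rightarrow> 'h::real_inner"
  assumes fg: "is_cond_exp M G f g" and h: "simple_function G h" and sp: "space G = space M"
  shows "has_bochner_integral M (\<lambda>x. inner (h x) (f x - g x)) 0"
proof -
  define A where "A c = h -` {c} \<inter> space M" for c
  have zero: "has_bochner_integral M (\<lambda>x. indicator (A c) x * inner c (f x - g x)) 0"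
    if "c \<in> h ` space M" for c
  proof -
    have "A c \<in> sets G"
      using simple_functionD(2)[OF h, of "{c}"] by (simp add: A_def sp)
    \<comment> \<open>The same \<open>I\<close> serves for \<open>f\<close> and \<open>g\<close>, so
      the two integrals cancel in the difference below.\<close>
    then obtain I where "has_strong_integral M (\<lambda>x. indicator (A c) x *\<^sub>R f x) I"
      "has_strong_integral M (\<lambda>x. indicator (A c) x *\<^sub>R g x) I"
      using fg unfolding is_cond_exp_def by blast
    from has_bochner_integral_diff[OF this[THEN has_strong_integral_inner[where c = c]]]
    show ?thesis by (simp add: inner_diff_right algebra_simps)
  qed
  have fin: "finite (h ` space M)"
    using simple_functionD(1)[OF h] by (simp add: sp)
  have "has_bochner_integral M
      (\<lambda>x. \<Sum>c\<in>h ` space M. indicator (A c) x * inner c (f x - g x)) (\<Sum>c\<in>h ` space M. 0)"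
    by (rule has_bochner_integral_sum) (rule zero)
  moreover have "(\<Sum>c\<in>h ` space M. indicator (A c) x * inner c (f x - g x)) = inner (h x) (f x - g x)"
    if "x \<in> space M" for x
  proof -
    have "(\<Sum>c\<in>h ` space M. indicator (A c) x * inner c (f x - g x))
        = (\<Sum>c\<in>h ` space M. if c = h x then inner (h x) (f x - g x) else 0)"
      by (rule sum.cong) (use that in \<open>auto simp: A_def indicator_def\<close>)
    also have "\<dots> = inner (h x) (f x - g x)"
      using fin that by simp
    finally show ?thesis .
  qed
  ultimately show ?thesis
    by (simp cong: has_bochner_integral_cong)
qed

text \<open>Dominated convergence extends the simple case: simple approximants of a bounded
  \<open>h\<close> can be truncated to be uniformly bounded, so a multiple of
  \<open>norm (f x - g x)\<close> dominates.\<close>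

lemma is_cond_exp_bounded_orthogonal:
  fixes f g :: "'a \<Rightarrow> 'h::real_inner"
  assumes fg: "is_cond_exp M G f g" and h: "strongly_measurable G h" and sp: "space G = space M"
    and int: "integrable M (\<lambda>x. norm (f x - g x))"
    and bound: "\<And>x. x \<in> space M \<Longrightarrow> norm (h x) \<le> K"
  shows "has_bochner_integral M (\<lambda>x. inner (h x) (f x - g x)) 0"
proof -
  obtain s where s: "\<And>i. simple_function G (s i)"
    and lim: "\<And>x. x \<in> space M \<Longrightarrow> (\<lambda>i. s i x) \<longlonglongrightarrow> h x"
    using h unfolding strongly_measurable_def sp by blast
  \<comment> \<open>Cutting at \<open>K + 1\<close> instead of \<open>K\<close> leaves room for
    approximants that approach a point of norm \<open>K\<close> from outside: at each point the
    truncation is eventually inactive.\<close>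
  define t where "t i x = (if norm (s i x) \<le> K + 1 then s i x else 0)" for i x
  have t: "simple_function G (t i)" for i
    unfolding t_def by (rule simple_function_compose1[OF s])
  have t_le: "norm (t i x) \<le> \<bar>K\<bar> + 1" for i x
    by (auto simp: t_def)
  have t_lim: "(\<lambda>i. t i x) \<longlonglongrightarrow> h x" if x: "x \<in> space M" for x
  proof (rule Lim_transform_eventually[OF lim[OF x]])
    have "\<forall>\<^sub>F i in sequentially. norm (s i x) < K + 1"
      by (rule order_tendstoD(2)[OF tendsto_norm[OF lim[OF x]]]) (use bound[OF x] in simp)
    then show "\<forall>\<^sub>F i in sequentially. s i x = t i x"
      by eventually_elim (simp add: t_def)
  qed
  note orth = is_cond_exp_simple_orthogonal[OF fg t sp]
  have lim_inner: "(\<lambda>i. inner (t i x) (f x - g x)) \<longlonglongrightarrow> inner (h x) (f x - g x)"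
    if "x \<in> space M" for x
    by (intro tendsto_intros t_lim that)
  have meas: "(\<lambda>x. inner (h x) (f x - g x)) \<in> borel_measurable M"
    by (rule borel_measurable_LIMSEQ_real[OF lim_inner])
      (use orth in \<open>auto dest: borel_measurable_has_bochner_integral\<close>)
  have dom: "integrable M (\<lambda>x. (\<bar>K\<bar> + 1) * norm (f x - g x))"
    using int by simp
  have dom_le: "norm (inner (t i x) (f x - g x)) \<le> (\<bar>K\<bar> + 1) * norm (f x - g x)" for i x
    using Cauchy_Schwarz_ineq2[of "t i x" "f x - g x"] mult_right_mono[OF t_le norm_ge_zero]
    by (metis order_trans real_norm_def)
  note dct = meas borel_measurable_has_bochner_integral[OF orth] dom AE_I2[OF lim_inner]
    AE_I2[OF dom_le]
  have "(\<lambda>i. integral\<^sup>L M (\<lambda>x. inner (t i x) (f x - g x)))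
      \<longlonglongrightarrow> integral\<^sup>L M (\<lambda>x. inner (h x) (f x - g x))"
    by (rule integral_dominated_convergence[OF dct])
  then have "integral\<^sup>L M (\<lambda>x. inner (h x) (f x - g x)) = 0"
    using has_bochner_integral_integral_eq[OF orth] by (simp add: LIMSEQ_const_iff)
  then show ?thesis
    using integrable_dominated_convergence[OF dct] by (simp add: has_bochner_integral_iff)
qed

text \<open>For unbounded \<open>h\<close>, cut off to where \<open>norm (h x) \<le> i\<close> and
  let \<open>i\<close> grow; the integrable product \<open>norm (h x) * norm (f x - g x)\<close>
  dominates. Integrability of this product is what the predictable weights will satisfy, although
  they may be unbounded.\<close>

lemma is_cond_exp_orthogonal:
  fixes f g :: "'a \<Rightarrow> 'h::real_inner"
  assumes fg: "is_cond_exp M G f g" and h: "strongly_measurable G h" and sp: "space G = space M"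
    and int: "integrable M (\<lambda>x. norm (f x - g x))"
    and inth: "integrable M (\<lambda>x. norm (h x) * norm (f x - g x))"
  shows "has_bochner_integral M (\<lambda>x. inner (h x) (f x - g x)) 0"
proof -
  define t where "t i x = indicator {x \<in> space G. norm (h x) \<le> real i} x *\<^sub>R h x" for i x
  have t: "strongly_measurable G (t i)" for i
    unfolding t_def
    by (intro strongly_measurable_scaleR h borel_measurable_indicator borel_measurable_le
        strongly_measurable_norm) simp
  have orth: "has_bochner_integral M (\<lambda>x. inner (t i x) (f x - g x)) 0" for i
    by (rule is_cond_exp_bounded_orthogonal[OF fg t sp int, where K = "real i"])
      (auto simp: t_def indicator_def)
  have lim_inner: "(\<lambda>i. inner (t i x) (f x - g x)) \<longlonglongrightarrow> inner (h x) (f x - g x)"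
    if x: "x \<in> space M" for x
  proof (rule tendsto_eventually)
    obtain n where n: "norm (h x) \<le> real n"
      using real_arch_simple by blast
    show "\<forall>\<^sub>F i in sequentially. inner (t i x) (f x - g x) = inner (h x) (f x - g x)"
      using eventually_ge_at_top[of n]
    proof eventually_elim
      case (elim i)
      then have "norm (h x) \<le> real i"
        using n by linarith
      then show ?case
        using x by (simp add: t_def sp)
    qed
  qed
  have meas: "(\<lambda>x. inner (h x) (f x - g x)) \<in> borel_measurable M"
    by (rule borel_measurable_LIMSEQ_real[OF lim_inner])
      (use orth in \<open>auto dest: borel_measurable_has_bochner_integral\<close>)
  have dom_le: "norm (inner (t i x) (f x - g x)) \<le> norm (h x) * norm (f x - g x)" for i x
    using Cauchy_Schwarz_ineq2[of "h x" "f x - g x"] by (simp add: t_def indicator_def)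
  note dct = meas borel_measurable_has_bochner_integral[OF orth] inth AE_I2[OF lim_inner]
    AE_I2[OF dom_le]
  have "(\<lambda>i. integral\<^sup>L M (\<lambda>x. inner (t i x) (f x - g x)))
      \<longlonglongrightarrow> integral\<^sup>L M (\<lambda>x. inner (h x) (f x - g x))"
    by (rule integral_dominated_convergence[OF dct])
  then have "integral\<^sup>L M (\<lambda>x. inner (h x) (f x - g x)) = 0"
    using has_bochner_integral_integral_eq[OF orth] by (simp add: LIMSEQ_const_iff)
  then show ?thesis
    using integrable_dominated_convergence[OF dct] by (simp add: has_bochner_integral_iff)
qed

section \<open>The pathwise inequality\<close>

text \<open>Put \<open>q = (norm x)\<^sup>2 - 2 * inner x y\<close>. Expanding both squared
  increments and the linear term reduces the claim to
  \<open>q / m' * v' \<le> q / m * v + C * (m' * v' - m * v)\<close>. The passage from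
  \<open>v / m\<close> to \<open>v' / m'\<close> is made in two moves, first changing
  \<open>m\<close> (estimate \<open>A\<close>, cost 2), then \<open>v\<close> (estimate
  \<open>B\<close>, cost 3).\<close>

lemma davis_step:
  fixes x y :: "'h::real_inner"
  assumes x: "norm x \<le> m" and m': "m' = max m (norm y)" and v: "0 \<le> v" "v \<le> v'"
    and C: "2 \<le> C" "3 \<le> C \<or> v' = v"
  shows "(norm (y - x))\<^sup>2 / m' * v' \<le> (norm y)\<^sup>2 / m' * v' - (norm x)\<^sup>2 / m * v
    - 2 * inner ((v / m) *\<^sub>R x) (y - x) + C * (m' * v' - m * v)"
proof (cases "m = 0")
  case True
  \<comment> \<open>Division by zero gives \<open>0\<close>, so the terms over \<open>m\<close>
    vanish. The terms in \<open>y\<close> agree on both sides and \<open>C * (m' * v')\<close> is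
    nonnegative.\<close>
  then have "x = 0" using x by simp
  then show ?thesis using True C v m' by simp
next
  case False
  then have m0: "0 < m" using x norm_ge_zero[of x] by linarith
  have mm': "m \<le> m'" and y: "norm y \<le> m'" and m'0: "0 < m'"
    using m' m0 by auto
  have d: "(norm (y - x))\<^sup>2 = (norm y)\<^sup>2 - 2 * inner x y + (norm x)\<^sup>2"
    by (simp add: power2_norm_eq_inner inner_diff_left inner_diff_right inner_commute)
  have xy: "\<bar>inner x y\<bar> \<le> m * m'"
    using Cauchy_Schwarz_ineq2[of x y] mult_mono[OF x y] m0
    by (auto intro: order_trans)
  \<comment> \<open>This is \<open>A\<close> with denominators cleared: dropping the square of
    \<open>norm x\<close> leaves \<open>2 * inner x y \<le> 2 * (m * m')\<close>, the source of the
    constant 2.\<close>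
  have "(2 * inner x y - (norm x)\<^sup>2) * (m' - m) \<le> (2 * (m * m')) * (m' - m)"
    by (rule mult_right_mono) (use xy mm' in \<open>auto intro: order_trans[of _ "2 * inner x y"]\<close>)
  then have "((norm x)\<^sup>2 - 2 * inner x y) * m
      \<le> ((norm x)\<^sup>2 - 2 * inner x y + 2 * (m' - m) * m) * m'"
    by (simp add: algebra_simps)
  then have A: "((norm x)\<^sup>2 - 2 * inner x y) / m' \<le> ((norm x)\<^sup>2 - 2 * inner x y) / m + 2 * (m' - m)"
    using m0 m'0 by (simp add: field_simps)
  \<comment> \<open>The constant 3 is one from the square of \<open>norm x\<close> plus two from the
    inner product, each measured against the square of \<open>m'\<close>.\<close>
  have "(norm x)\<^sup>2 \<le> m'\<^sup>2" "m * m' \<le> m'\<^sup>2"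
    using x mm' m'0 by (auto simp: power2_eq_square intro!: mult_mono)
  then have "(norm x)\<^sup>2 - 2 * inner x y \<le> 3 * m'\<^sup>2"
    using xy by linarith
  then have B: "((norm x)\<^sup>2 - 2 * inner x y) / m' \<le> 3 * m'"
    using m'0 by (simp add: field_simps power2_eq_square)
  have "((norm x)\<^sup>2 - 2 * inner x y) / m' * v'
      = ((norm x)\<^sup>2 - 2 * inner x y) / m' * v + ((norm x)\<^sup>2 - 2 * inner x y) / m' * (v' - v)"
    by (subst distrib_left[symmetric]) simp
  \<comment> \<open>The costs match the splitting
    \<open>m' * v' - m * v = (m' - m) * v + m' * (v' - v)\<close>. The second summand, which demands
    3, vanishes when \<open>v' = v\<close>.\<close>
  also have "\<dots> \<le> (((norm x)\<^sup>2 - 2 * inner x y) / m + 2 * (m' - m)) * v + 3 * m' * (v' - v)"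
    using A B v by (intro add_mono mult_right_mono) auto
  also have "\<dots> \<le> ((norm x)\<^sup>2 - 2 * inner x y) / m * v + C * (m' * v' - m * v)"
  proof -
    have "2 * ((m' - m) * v) \<le> C * ((m' - m) * v)"
      using C v mm' by (intro mult_right_mono) auto
    moreover have "3 * (m' * (v' - v)) \<le> C * (m' * (v' - v))"
    proof (cases "v' = v")
      case False
      then show ?thesis using C v m'0 by (intro mult_right_mono) auto
    qed simp
    ultimately show ?thesis by (simp add: algebra_simps)
  qed
  finally show ?thesis
    unfolding d using m0
    by (simp add: inner_diff_right power2_norm_eq_inner diff_divide_distrib add_divide_distrib
        algebra_simps)
qed

section \<open>Running maxima\<close>

lemma running_max_0 [simp]: "running_max u 0 x = u 0 x"
  by (simp add: running_max_def)

lemma running_max_Suc: "running_max u (Suc n) x = max (running_max u n x) (u (Suc n) x)"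
  by (simp add: running_max_def atMost_Suc max.commute)

lemma running_max_ge: "k \<le> n \<Longrightarrow> u k x \<le> running_max u n x"
  by (simp add: running_max_def)

lemma running_max_mono: "k \<le> n \<Longrightarrow> running_max u k x \<le> running_max u n x"
  unfolding running_max_def by (rule Max_mono) auto

lemma borel_measurable_running_max:
  assumes "\<And>k. k \<le> n \<Longrightarrow> u k \<in> borel_measurable M"
  shows "running_max u n \<in> borel_measurable M"
  using assms
proof (induction n)
  case 0
  then show ?case by (simp add: running_max_def)
next
  case (Suc n)
  then show ?case
    by (subst running_max_Suc[abs_def]) (auto intro: borel_measurable_max)
qed

lemma max_fun_0 [simp]: "max_fun f 0 x = norm (f 0 x)"
  by (simp add: max_fun_def)

lemma max_fun_Suc: "max_fun f (Suc n) x = max (max_fun f n x) (norm (f (Suc n) x))"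
  by (simp add: max_fun_def running_max_Suc)

lemma norm_le_max_fun: "k \<le> n \<Longrightarrow> norm (f k x) \<le> max_fun f n x"
  unfolding max_fun_def by (rule running_max_ge[of k n "\<lambda>k x. norm (f k x)"])

lemma max_fun_mono: "k \<le> n \<Longrightarrow> max_fun f k x \<le> max_fun f n x"
  unfolding max_fun_def by (rule running_max_mono)

lemma max_fun_nonneg: "0 \<le> max_fun f n x"
  using norm_le_max_fun[of n n f x] norm_ge_zero[of "f n x"] by linarith

lemma norm_mdiff_le:
  assumes "n \<le> N"
  shows "norm (mdiff f n x) \<le> 2 * max_fun f N x"
  using norm_triangle_ineq4[of "f n x" "f (n - 1) x"] norm_le_max_fun[OF assms, of f x]
    norm_le_max_fun[OF order_trans[OF diff_le_self assms], of f 1 x] by (simp add: mdiff_def)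

text \<open>Summing \<open>davis_step\<close> telescopes. The constant \<open>C + 1\<close> on the
  initial term collects \<open>C\<close> from the telescoped maxima and 1 from
  \<open>(norm (f 0 x))\<^sup>2 / norm (f 0 x) = norm (f 0 x)\<close>, which also holds where
  \<open>f 0 x = 0\<close>.\<close>

lemma davis_pathwise:
  fixes f :: "nat \<Rightarrow> 'a \<Rightarrow> 'h::real_inner" and v :: "nat \<Rightarrow> 'a \<Rightarrow> real"
  assumes v: "\<And>n. 0 \<le> v n x" "\<And>n. v n x \<le> v (Suc n) x"
    and C: "2 \<le> C" "3 \<le> C \<or> (\<forall>n. v (Suc n) x = v n x)"
  shows "(C + 1) * (norm (f 0 x) * v 0 x)
      + (\<Sum>n=1..N. (norm (mdiff f n x))\<^sup>2 / max_fun f n x * v n x)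
    \<le> (norm (f N x))\<^sup>2 / max_fun f N x * v N x + C * (max_fun f N x * v N x)
      - 2 * (\<Sum>n=1..N. inner ((v (n - 1) x / max_fun f (n - 1) x) *\<^sub>R f (n - 1) x) (mdiff f n x))"
proof (induction N)
  case 0
  then show ?case by (simp add: power2_eq_square algebra_simps)
next
  case (Suc N)
  have "(norm (f (Suc N) x - f N x))\<^sup>2 / max_fun f (Suc N) x * v (Suc N) x
    \<le> (norm (f (Suc N) x))\<^sup>2 / max_fun f (Suc N) x * v (Suc N) x
      - (norm (f N x))\<^sup>2 / max_fun f N x * v N x
      - 2 * inner ((v N x / max_fun f N x) *\<^sub>R f N x) (f (Suc N) x - f N x)
      + C * (max_fun f (Suc N) x * v (Suc N) x - max_fun f N x * v N x)"
    using C by (intro davis_step norm_le_max_fun max_fun_Suc v) auto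
  with Suc.IH show ?case
    by (simp add: mdiff_def right_diff_distrib distrib_left)
qed

section \<open>The weighted Davis inequality\<close>

text \<open>Taking expectations in \<open>davis_pathwise\<close> removes the linear terms. Both
  inequalities of the theorem come from this form: \<open>v = 1\<close> with \<open>C = 2\<close>,
  and the running maximum of the weights with \<open>C = 3\<close>.\<close>

lemma weighted_davis:
  fixes f :: "nat \<Rightarrow> 'a \<Rightarrow> 'h::real_inner" and v :: "nat \<Rightarrow> 'a \<Rightarrow> real"
  assumes F: "filtered_prob_space M F" and f: "martingale M F f"
    and v_meas: "\<And>n. v n \<in> borel_measurable (F n)"
    and v: "\<And>n x. x \<in> space M \<Longrightarrow> 0 \<le> v n x" "\<And>n x. x \<in> space M \<Longrightarrow> v n x \<le> v (Suc n) x"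
    and C: "2 \<le> C" "3 \<le> C \<or> (\<forall>n. \<forall>x\<in>space M. v (Suc n) x = v n x)"
  shows "(\<integral>\<^sup>+x. ennreal (norm (f 0 x) * v 0 x +
            1 / (C + 1) * (\<Sum>n=1..N. (norm (mdiff f n x))\<^sup>2 / max_fun f n x * v n x)) \<partial>M)
         \<le> (\<integral>\<^sup>+x. ennreal (max_fun f N x * v N x) \<partial>M)"
proof (cases "(\<integral>\<^sup>+x. ennreal (max_fun f N x * v N x) \<partial>M) = \<infinity>")
  \<comment> \<open>An infinite right-hand side leaves nothing to prove. Finiteness supplies the
    integrable majorant \<open>max_fun f N x * v N x\<close> for all the linear terms.\<close>
  case False
  interpret filtered_prob_space M F by (rule F)
  have v_mono: "v k x \<le> v n x" if "k \<le> n" "x \<in> space M" for k n x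
    using lift_Suc_mono_le[of "\<lambda>n. v n x", OF v(2)[OF that(2)] that(1)] .
  have sm_F: "strongly_measurable (F n) (f k)" if "k \<le> n" for k n
    by (rule strongly_measurable_subalgebra[of "F k"])
      (use f that sets_F_mono[of k n] in \<open>auto simp: martingale_def subalgebra_def space_F\<close>)
  have max_F: "max_fun f n \<in> borel_measurable (F n)" for n
    unfolding max_fun_def
    by (intro borel_measurable_running_max strongly_measurable_norm sm_F)
  note toM = measurable_from_subalg[OF subalgebra_F]
  have sm: "strongly_measurable M (f n)" for n
    by (rule strongly_measurable_subalgebra[OF sm_F[OF order_refl] subalgebra_F])
  have d_sm: "strongly_measurable M (mdiff f n)" for n
    using strongly_measurable_diff[OF sm sm, of n "n - 1"] by (simp add: mdiff_def[abs_def])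
  note [measurable] = toM[OF max_F] toM[OF v_meas] strongly_measurable_norm[OF sm]
    strongly_measurable_norm[OF d_sm]
  have int: "integrable M (\<lambda>x. max_fun f N x * v N x)"
    using False by (intro integrableI_nonneg)
      (auto intro!: AE_I2 mult_nonneg_nonneg max_fun_nonneg v simp: less_top)
  \<comment> \<open>The shift to \<open>n - 1\<close> makes \<open>h n\<close> predictable, that is,
    measurable for \<open>F (n - 1)\<close>. Dividing by the maximal function normalises
    \<open>f (n - 1)\<close>, whence \<open>norm (h n x) \<le> v (n - 1) x\<close>.\<close>
  define h where "h n x = (v (n - 1) x / max_fun f (n - 1) x) *\<^sub>R f (n - 1) x" for n x
  have h_le: "norm (h n x) \<le> v (n - 1) x" if "x \<in> space M" for n x
    using norm_le_max_fun[of "n - 1" "n - 1" f x] max_fun_nonneg[of f "n - 1" x] v(1)[OF that, of "n - 1"]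
    by (cases "max_fun f (n - 1) x = 0")
      (auto simp: h_def pos_divide_le_eq mult_left_mono)
  have h_sm: "strongly_measurable (F (n - 1)) (h n)" for n
    unfolding h_def
    by (intro strongly_measurable_scaleR sm_F borel_measurable_divide v_meas max_F) simp
  have orth: "has_bochner_integral M (\<lambda>x. inner (h n x) (mdiff f n x)) 0" if n: "n \<in> {1..N}" for n
    unfolding mdiff_def
  proof (rule is_cond_exp_orthogonal[OF _ h_sm])
    show "is_cond_exp M (F (n - 1)) (f n) (f (n - 1))"
      using f by (simp add: martingale_def)
    show "space (F (n - 1)) = space M"
      by (rule space_F)
    have intf: "integrable M (\<lambda>x. norm (f k x))" for k
      using f has_strong_integral_integrable_norm unfolding martingale_def by blast
    show "integrable M (\<lambda>x. norm (f n x - f (n - 1) x))"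
      by (rule Bochner_Integration.integrable_bound[OF Bochner_Integration.integrable_add[OF intf intf]])
        (auto intro!: AE_I2 norm_triangle_ineq4 strongly_measurable_norm strongly_measurable_diff sm)
    \<comment> \<open>Monotonicity of \<open>v\<close> moves the weight up to time \<open>N\<close>,
      and the increment is at most twice the maximal function at time \<open>N\<close>.\<close>
    have hd_le: "norm (h n x) * norm (mdiff f n x) \<le> 2 * (max_fun f N x * v N x)" if x: "x \<in> space M" for x
    proof -
      have "norm (h n x) \<le> v N x"
        by (rule order_trans[OF h_le[OF x] v_mono[OF _ x]]) (use n in auto)
      then have "norm (h n x) * norm (mdiff f n x) \<le> v N x * (2 * max_fun f N x)"
        using n v(1)[OF x] by (intro mult_mono norm_mdiff_le) auto
      then show ?thesis by (simp add: ac_simps)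
    qed
    have le: "norm (norm (h n x) * norm (mdiff f n x)) \<le> norm (2 * (max_fun f N x * v N x))"
      if "x \<in> space M" for x
      using order_trans[OF hd_le[OF that] abs_ge_self]
      by (simp only: real_norm_def abs_mult abs_norm_cancel)
    have "(\<lambda>x. norm (h n x) * norm (mdiff f n x)) \<in> borel_measurable M"
      by (intro borel_measurable_times strongly_measurable_norm d_sm
          strongly_measurable_subalgebra[OF h_sm subalgebra_F])
    from Bochner_Integration.integrable_bound[OF integrable_mult_right[OF int, of 2] this AE_I2[OF le]]
    have "integrable M (\<lambda>x. norm (h n x) * norm (mdiff f n x))" .
    then show "integrable M (\<lambda>x. norm (h n x) * norm (f n x - f (n - 1) x))"
      by (simp only: mdiff_def)
  qed
  let ?S = "\<lambda>x. norm (f 0 x) * v 0 x +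
      1 / (C + 1) * (\<Sum>n=1..N. (norm (mdiff f n x))\<^sup>2 / max_fun f n x * v n x)"
  let ?L = "\<lambda>x. \<Sum>n=1..N. inner (h n x) (mdiff f n x)"
  let ?R = "\<lambda>x. max_fun f N x * v N x - 2 / (C + 1) * ?L x"
  have L: "has_bochner_integral M ?L 0"
    using has_bochner_integral_sum[of "{1..N}" M "\<lambda>n x. inner (h n x) (mdiff f n x)" "\<lambda>_. 0", OF orth]
    by simp
  have R: "integrable M ?R" "integral\<^sup>L M ?R = integral\<^sup>L M (\<lambda>x. max_fun f N x * v N x)"
    using L int by (auto simp: has_bochner_integral_iff)
  have S0: "0 \<le> ?S x" if "x \<in> space M" for x
    using C v(1)[OF that] by (intro add_nonneg_nonneg mult_nonneg_nonneg sum_nonneg)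
      (auto intro!: max_fun_nonneg divide_nonneg_nonneg)
  have le: "?S x \<le> ?R x" if x: "x \<in> space M" for x
  proof -
    \<comment> \<open>The terminal term left by telescoping costs one more copy of
      \<open>max_fun f N x * v N x\<close>, so \<open>C\<close> becomes \<open>C + 1\<close> on the
      right as well, and dividing by it gives \<open>?S x \<le> ?R x\<close>.\<close>
    have "(norm (f N x))\<^sup>2 / max_fun f N x \<le> max_fun f N x"
      using norm_le_max_fun[of N N f x] max_fun_nonneg[of f N x]
      by (cases "max_fun f N x = 0") (simp_all add: pos_divide_le_eq power2_eq_square mult_mono)
    then have "(norm (f N x))\<^sup>2 / max_fun f N x * v N x \<le> max_fun f N x * v N x"
      using v(1)[OF x] by (rule mult_right_mono)
    moreover have "(C + 1) * (norm (f 0 x) * v 0 x)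
        + (\<Sum>n=1..N. (norm (mdiff f n x))\<^sup>2 / max_fun f n x * v n x)
      \<le> (norm (f N x))\<^sup>2 / max_fun f N x * v N x + C * (max_fun f N x * v N x) - 2 * ?L x"
      unfolding h_def by (rule davis_pathwise[of v x, OF v[OF x] C(1)]) (use C(2) x in auto)
    moreover have scale: "(C + 1) * (a + 1 / (C + 1) * b) = (C + 1) * a + b"
      "(C + 1) * (a - 2 / (C + 1) * b) = a + C * a - 2 * b" for a b
      using C(1) by (simp_all add: field_simps)
    ultimately have "(C + 1) * ?S x \<le> (C + 1) * ?R x"
      unfolding scale by linarith
    then show ?thesis
      by (rule mult_left_le_imp_le) (use C(1) in simp)
  qed
  have "(\<integral>\<^sup>+x. ennreal (?S x) \<partial>M) \<le> (\<integral>\<^sup>+x. ennreal (?R x) \<partial>M)"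
    by (intro nn_integral_mono ennreal_leI le)
  \<comment> \<open>Lying above the nonnegative \<open>?S\<close>, the function \<open>?R\<close> is
    itself nonnegative, so its nonnegative integral is its Bochner integral, in which the martingale
    part contributes zero.\<close>
  also have "\<dots> = ennreal (integral\<^sup>L M ?R)"
    by (rule nn_integral_eq_integral[OF R(1)]) (rule AE_I2, rule order_trans[OF S0 le])
  also have "\<dots> = (\<integral>\<^sup>+x. ennreal (max_fun f N x * v N x) \<partial>M)"
    unfolding R(2)
    by (rule nn_integral_eq_integral[symmetric, OF int])
      (auto intro!: AE_I2 mult_nonneg_nonneg max_fun_nonneg v)
  finally show ?thesis .
qed simp

theorem theorem1p1:
  fixes M :: "'a measure" and F :: "nat \<Rightarrow> 'a measure"
    and f :: "nat \<Rightarrow> 'a \<Rightarrow> 'h::{real_inner, complete_space}"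
    and w :: "nat \<Rightarrow> 'a \<Rightarrow> real"
    and N :: nat
  assumes "filtered_prob_space M F"
    and "martingale M F f"
    and "\<And>n. weight M (w n)"
    and "\<And>n. w n \<in> borel_measurable (F n)"
  shows "(\<integral>\<^sup>+x. ennreal (norm (f 0 x) +
              1 / 3 * (\<Sum>n=1..N. (norm (mdiff f n x))\<^sup>2 / max_fun f n x)) \<partial>M)
           \<le> (\<integral>\<^sup>+x. ennreal (max_fun f N x) \<partial>M)
       \<and> (\<integral>\<^sup>+x. ennreal (norm (f 0 x) * w 0 x +
              1 / 4 * (\<Sum>n=1..N. (norm (mdiff f n x))\<^sup>2 / max_fun f n x * w n x)) \<partial>M)
           \<le> (\<integral>\<^sup>+x. ennreal (max_fun f N x * running_max w N x) \<partial>M)"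
proof
  \<comment> \<open>A constant weight never increases, so \<open>C = 2\<close> is admissible and
    \<open>1 / (C + 1)\<close> is the required one third.\<close>
  show "(\<integral>\<^sup>+x. ennreal (norm (f 0 x) +
              1 / 3 * (\<Sum>n=1..N. (norm (mdiff f n x))\<^sup>2 / max_fun f n x)) \<partial>M)
           \<le> (\<integral>\<^sup>+x. ennreal (max_fun f N x) \<partial>M)"
    using weighted_davis[OF assms(1,2), of "\<lambda>_ _. 1" 2 N] by simp
next
  interpret filtered_prob_space M F by (rule assms(1))
  \<comment> \<open>The weights may decrease, so they are replaced by their running maximum, which
    is adapted and nondecreasing. It equals \<open>w 0\<close> at time 0 and only enlarges the later
    terms on the left, while the right-hand side already contains it.\<close>
  let ?v = "running_max w"
  have w: "0 < w n x" if "x \<in> space M" for n x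
    using assms(3) that by (simp add: weight_def)
  have v_meas: "?v n \<in> borel_measurable (F n)" for n
  proof (rule borel_measurable_running_max)
    fix k assume "k \<le> n"
    then have "subalgebra (F n) (F k)"
      using sets_F_mono by (simp add: subalgebra_def space_F)
    then show "w k \<in> borel_measurable (F n)"
      by (rule measurable_from_subalg) (rule assms(4))
  qed
  have "(\<integral>\<^sup>+x. ennreal (norm (f 0 x) * w 0 x +
            1 / 4 * (\<Sum>n=1..N. (norm (mdiff f n x))\<^sup>2 / max_fun f n x * w n x)) \<partial>M)
      \<le> (\<integral>\<^sup>+x. ennreal (norm (f 0 x) * ?v 0 x +
            1 / (3 + 1) * (\<Sum>n=1..N. (norm (mdiff f n x))\<^sup>2 / max_fun f n x * ?v n x)) \<partial>M)"
    unfolding running_max_0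
    by (rule nn_integral_mono, rule ennreal_leI, rule add_left_mono, rule mult_mono,
        simp, rule sum_mono)
      (auto intro!: mult_left_mono running_max_ge divide_nonneg_nonneg max_fun_nonneg sum_nonneg
        mult_nonneg_nonneg less_imp_le[OF w] simp del: times_divide_eq_left)
  also have "\<dots> \<le> (\<integral>\<^sup>+x. ennreal (max_fun f N x * ?v N x) \<partial>M)"
  proof (rule weighted_davis[OF assms(1,2) v_meas])
    show "0 \<le> ?v n x" if "x \<in> space M" for n x
      using w[OF that, of n] running_max_ge[of n n w x] by linarith
  qed (auto intro: running_max_mono)
  finally show "(\<integral>\<^sup>+x. ennreal (norm (f 0 x) * w 0 x +
            1 / 4 * (\<Sum>n=1..N. (norm (mdiff f n x))\<^sup>2 / max_fun f n x * w n x)) \<partial>M)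
      \<le> (\<integral>\<^sup>+x. ennreal (max_fun f N x * ?v N x) \<partial>M)" .
qed

end
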